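(* Assume (A1)-(A5) (see context) hold on the local region $(\Omega,V)$, where $V\subset\mathbb{R}^{N\times d}$ is an open ball centred at $Y^*$, and that the iterates satisfy $\theta_k\in\Omega$ for all $k\ge 0$ almost surely. Suppose $F$ is convex on $V$, where $Y^*$ is a minimum point of $F$. Let $c_2=\frac12(LB_1^2+B_0B_2)B_1^2$. If the fixed step size $\eta>0$ satisfies $$\eta<\frac{b}{N}\cdot\frac{\lambda_{\min}}{c_2},$$ then there exists a constant $C>0$ such that for all $k\ge1$ $$\mathbb{E}[F(Y(\theta_k))]-F(Y^* )\le\frac{C}{k},$$ where the expectation is over the batches $\mathcal B_0,\dots,\mathcal B_{k-1}$.
   Context: Setting. $N,d,s\ge1$ are integers; $Y:\mathbb{R}^s\to\mathbb{R}^{N\times d}$ is $C^2$ (its $n$-th row $Y_n(\theta)$ is the output on sample $n$) and $F:\mathbb{R}^{N\times d}\to\mathbb{R}$ is $C^1$. $\nabla_YF(Y)\in\mathbb{R}^{N\times d}$ is the gradient, with $n$-th row $(\nabla_YF)_n$ (a row vector in $\mathbb{R}^d$). $\nabla_\theta Y_n(\theta)\in\mathbb{R}^{d\times s}$ is the Jacobian of $Y_n$, and $\nabla_\theta Y(\theta)\in\mathbb{R}^{Nd\times s}$ is the vertical concatenation of the $\nabla_\theta Y_n(\theta)$. $\nabla_\theta^2Y$ is the tensor of second derivatives. $\|\cdot\|_{\mathrm F}$ is the Frobenius norm (Euclidean norm of all entries). Algorithm (ideal per-batch gradient). Starting from a deterministic $\theta_0\in\mathbb{R}^s$, at each step $k$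 a random batch $\mathcal B_k\subset\{1,\dots,N\}$ of fixed size $b=|\mathcal B_k|$ is drawn, independently of the past, with every index belonging to $\mathcal B_k$ with probability $b/N$. Set $G_k=\sum_{n\in\mathcal B_k}(\nabla_YF(Y(\theta_k)))_n\,\nabla_\theta Y_n(\theta_k)\in\mathbb{R}^{1\times s}$ and $\theta_{k+1}=\theta_k-\eta G_k^\top$, with fixed step size $\eta>0$. Local region and assumptions. $\Omega\subset\mathbb{R}^s$ is an open convex set and $V\subset\mathbb{R}^{N\times d}$ is a convex set with $Y(\Omega)\subset V$. There are positive constants $B_0,L,B_1,B_2,\lambda_{\min}$ such that: (A1) $\|\nabla_YF(Y)\|_{\mathrm F}\le B_0$ for $Y\in V$; (A2) $\|\nabla_YF(Y)-\nabla_YF(Y')\|_{\mathrm F}\le L\|Y-Y'\|_{\mathrm F}$ for $Y,Y'\in V$; (A3) $\|\nabla_\theta Y(\theta)\|_{\mathrm F}\le B_1$ for $\theta\in\Omega$; (A4) $\|\nabla_\theta^2Y(\theta)\|_{\mathrm F}\le B_2$ for $\theta\in\Omega$; (A5) the smallest eigenvalue of $\nabla_\theta Y(\theta)\nabla_\theta Y(\theta)^\top\in\mathbb{R}^{Nd\times Nd}$ is at least $\lambda_{\min}>0$ for $\theta\in\Omega$. *)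

theory Defs
  imports "HOL-Analysis.Analysis" "HOL-Probability.Probability"
begin

(* Nested vectors carry the Euclidean norm of all their entries, so norm is the Frobenius norm on
   matrices real^'d^'n ('n rows, 'd columns) and on third-order tensors. *)

definition C1_function :: "('a::real_normed_vector \<Rightarrow> 'b::real_normed_vector) \<Rightarrow> bool" where
  "C1_function f \<longleftrightarrow>
     (\<exists>f' :: 'a \<Rightarrow> 'a \<Rightarrow>\<^sub>L 'b.
        (\<forall>x. (f has_derivative blinfun_apply (f' x)) (at x)) \<and> continuous_on UNIV f')"

definition C2_function :: "('a::real_normed_vector \<Rightarrow> 'b::real_normed_vector) \<Rightarrow> bool" where
  "C2_function f \<longleftrightarrow>
     (\<exists>f' :: 'a \<Rightarrow> 'a \<Rightarrow>\<^sub>L 'b.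
        (\<forall>x. (f has_derivative blinfun_apply (f' x)) (at x)) \<and> C1_function f')"

(* Meaningful only where F is differentiable; on matrices the inner product underlying GDERIV is
   the entrywise one, so the gradient is the matrix of partial derivatives. *)
definition gradient :: "('a::real_inner \<Rightarrow> real) \<Rightarrow> 'a \<Rightarrow> 'a" where
  "gradient F x = (THE D. GDERIV F x :> D)"

definition row_jacobian :: "(real^'s \<Rightarrow> real^'d^'n) \<Rightarrow> 'n \<Rightarrow> real^'s \<Rightarrow> real^'s^'d" where
  "row_jacobian Y n \<theta> = jacobian (\<lambda>\<theta>. Y \<theta> $ n) (at \<theta>)"

(* The Nd rows of the concatenated Jacobian are indexed by pairs (n, i). *)
definition full_jacobian :: "(real^'s \<Rightarrow> real^'d^'n) \<Rightarrow> real^'s \<Rightarrow> real^'s^('n \<times> 'd)" where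
  "full_jacobian Y \<theta> = (\<chi> p. row_jacobian Y (fst p) \<theta> $ snd p)"

(* Entry (n, i), j, k is the k-th partial derivative of entry ((n, i), j) of the Jacobian. *)
definition second_derivative_tensor ::
    "(real^'s \<Rightarrow> real^'d^'n) \<Rightarrow> real^'s \<Rightarrow> real^'s^'s^('n \<times> 'd)" where
  "second_derivative_tensor Y \<theta> = (\<chi> p. jacobian (\<lambda>\<theta>. full_jacobian Y \<theta> $ p) (at \<theta>))"

definition eigenvalue :: "real^'m^'m \<Rightarrow> real \<Rightarrow> bool" where
  "eigenvalue A c \<longleftrightarrow> (\<exists>v. v \<noteq> 0 \<and> A *v v = c *s v)"

(* For symmetric A the set of real eigenvalues is finite and nonempty, so Min is well behaved. *)
definition smallest_eigenvalue :: "real^'m^'m \<Rightarrow> real" where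
  "smallest_eigenvalue A = Min {c. eigenvalue A c}"

definition batch_gradient ::
    "(real^'s \<Rightarrow> real^'d^'n) \<Rightarrow> (real^'d^'n \<Rightarrow> real) \<Rightarrow> 'n set \<Rightarrow> real^'s \<Rightarrow> real^'s" where
  "batch_gradient Y F B \<theta> = (\<Sum>n\<in>B. gradient F (Y \<theta>) $ n v* row_jacobian Y n \<theta>)"

primrec sgd_iterate ::
    "(real^'s \<Rightarrow> real^'d^'n) \<Rightarrow> (real^'d^'n \<Rightarrow> real) \<Rightarrow> real \<Rightarrow> real^'s \<Rightarrow> (nat \<Rightarrow> 'n set) \<Rightarrow>
     nat \<Rightarrow> real^'s" where
  "sgd_iterate Y F \<eta> \<theta>0 B 0 = \<theta>0"
| "sgd_iterate Y F \<eta> \<theta>0 B (Suc k) =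
     sgd_iterate Y F \<eta> \<theta>0 B k - \<eta> *\<^sub>R batch_gradient Y F (B k) (sgd_iterate Y F \<eta> \<theta>0 B k)"

end

theory Submission
  imports Defs
begin

text \<open>
  Write \<open>h = F \<circ> Y\<close> and \<open>g\<^sub>k = \<nabla>F(Y(\<theta>\<^sub>k))\<close>. By (A1)--(A4) the gradient of \<open>h\<close> is Lipschitz on \<open>\<Omega>\<close> with constant
  \<open>L B\<^sub>1\<^sup>2 + B\<^sub>0 B\<^sub>2\<close>, so the descent lemma applies to each step. The batch gradient has mean
  \<open>b/N\<close> times \<open>\<nabla>h\<close> given the past and norm at most \<open>B\<^sub>1 \<parallel>g\<^sub>k\<parallel>\<close>, while (A5) gives
  \<open>\<parallel>\<nabla>h\<parallel>\<^sup>2 \<ge> \<mu>\<^sub>m\<^sub>i\<^sub>n \<parallel>g\<^sub>k\<parallel>\<^sup>2\<close>. Hence the expected loss drops by at least \<open>\<delta> E\<parallel>g\<^sub>k\<parallel>\<^sup>2\<close> with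
  \<open>\<delta> = \<eta> (b/N \<mu>\<^sub>m\<^sub>i\<^sub>n - \<eta> c\<^sub>2) > 0\<close>. Convexity on the ball of radius \<open>r\<close> bounds the gap \<open>h - F(Y\<^sup>*)\<close> by
  \<open>r \<parallel>g\<^sub>k\<parallel>\<close>, so with Jensen's inequality the expected gap satisfies \<open>a\<^sub>k\<^sub>+\<^sub>1 \<le> a\<^sub>k - (\<delta>/r\<^sup>2) a\<^sub>k\<^sup>2\<close>, which
  forces decay of order \<open>1/k\<close>.
\<close>

subsection \<open>Jacobians and gradients\<close>

text \<open>Cauchy-Schwarz in each row. The Frobenius norm thus dominates the operator norm, which
  is how the bounds (A3) and (A4) enter.\<close>

lemma norm_matrix_vector_mult_le:
  fixes A :: "real^'n^'m"
  shows "norm (A *v x) \<le> norm A * norm x"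
proof -
  have "norm (A *v x) = L2_set (\<lambda>i. norm ((A *v x) $ i)) UNIV"
    by (simp add: norm_vec_def)
  also have "\<dots> \<le> L2_set (\<lambda>i. norm (A $ i) * norm x) UNIV"
    by (intro L2_set_mono) (auto simp: matrix_vector_mul_component Cauchy_Schwarz_ineq2)
  also have "\<dots> = norm A * norm x"
    by (simp add: norm_vec_def L2_set_left_distrib)
  finally show ?thesis .
qed

lemma norm_transpose: "norm (transpose A) = norm (A :: real^'n^'m)"
proof -
  have "transpose A \<bullet> transpose A = (\<Sum>j\<in>UNIV. \<Sum>i\<in>UNIV. A $ i $ j * A $ i $ j)"
    by (simp add: inner_vec_def transpose_def)
  also have "\<dots> = A \<bullet> A"
    by (subst sum.swap) (simp add: inner_vec_def)
  finally show ?thesis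
    by (simp add: norm_eq_sqrt_inner)
qed

lemma norm_vector_matrix_mult_le:
  fixes A :: "real^'n^'m"
  shows "norm (x v* A) \<le> norm x * norm A"
  using norm_matrix_vector_mult_le[of "transpose A" x]
  by (simp add: norm_transpose mult.commute)

lemma has_derivative_vecI:
  fixes f :: "'a::real_normed_vector \<Rightarrow> 'b::euclidean_space^'n"
  assumes "\<And>i. ((\<lambda>x. f x $ i) has_derivative (\<lambda>h. f' h $ i)) (at x within S)"
  shows "(f has_derivative f') (at x within S)"
  unfolding has_derivative_componentwise_within[of f]
proof
  fix u :: "'b^'n" assume "u \<in> Basis"
  then obtain i v where u: "u = axis i v" by (auto simp: Basis_vec_def)
  show "((\<lambda>x. f x \<bullet> u) has_derivative (\<lambda>x. f' x \<bullet> u)) (at x within S)"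
    unfolding u inner_axis by (intro has_derivative_inner_left assms)
qed

lemma gradient_eqI:
  assumes "GDERIV f x :> D"
  shows "gradient f x = D"
  unfolding gradient_def
proof (rule the_equality)
  show "GDERIV f x :> D" by fact
next
  fix E assume "GDERIV f x :> E"
  with assms have "(\<lambda>h. h \<bullet> E) = (\<lambda>h. h \<bullet> D)"
    unfolding gderiv_def by (rule has_derivative_unique[rotated])
  then have "h \<bullet> (E - D) = 0" for h
    by (simp add: inner_diff_right fun_eq_iff)
  then show "E = D"
    by (metis eq_iff_diff_eq_0 inner_eq_zero_iff)
qed

text \<open>Riesz representation in finite dimension: the vector with coordinates \<open>D b\<close>
  on the basis represents the derivative. This supplies the existence that the definite description
  in \<open>gradient\<close> presupposes.\<close>

lemma has_derivative_gradient:
  fixes f :: "'a::euclidean_space \<Rightarrow> real"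
  assumes "f differentiable at x"
  shows "(f has_derivative (\<lambda>h. gradient f x \<bullet> h)) (at x)"
proof -
  from assms obtain D where D: "(f has_derivative D) (at x)"
    by (auto simp: differentiable_def)
  then interpret bounded_linear D by (rule has_derivative_bounded_linear)
  define d where "d = (\<Sum>b\<in>Basis. D b *\<^sub>R b)"
  have "D = (\<lambda>h. h \<bullet> d)"
  proof
    fix h
    have "D h = D (\<Sum>b\<in>Basis. (h \<bullet> b) *\<^sub>R b)" by (simp add: euclidean_representation)
    also have "\<dots> = h \<bullet> d" by (simp add: d_def sum scaleR inner_sum_right mult.commute)
    finally show "D h = h \<bullet> d" .
  qed
  with D have "GDERIV f x :> d" by (simp add: gderiv_def)
  from gradient_eqI[OF this] this show ?thesis by (simp add: gderiv_def inner_commute)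
qed

lemma C1_function_differentiable: "C1_function f \<Longrightarrow> f differentiable at x"
  by (auto simp: C1_function_def differentiable_def)

lemma C2_function_differentiable: "C2_function f \<Longrightarrow> f differentiable at x"
  by (auto simp: C2_function_def differentiable_def)

text \<open>The isometry from N by d matrices to vectors of length Nd, indexed like the rows of
  \<open>full_jacobian\<close>.\<close>

definition flatten :: "'a^'d^'n \<Rightarrow> 'a^('n \<times> 'd)" where
  "flatten y = (\<chi> p. y $ fst p $ snd p)"

lemma inner_flatten [simp]: "flatten x \<bullet> flatten y = x \<bullet> (y :: real^'d^'n)"
  by (simp add: flatten_def inner_vec_def sum.cartesian_product case_prod_beta flip: UNIV_Times_UNIV)

lemma norm_flatten [simp]: "norm (flatten y) = norm (y :: real^'d^'n)"
  by (simp add: norm_eq_sqrt_inner)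

lemma row_jacobian_mult:
  assumes D: "(Y has_derivative D) (at t)"
  shows "row_jacobian Y n t *v h = D h $ n"
proof -
  have 1: "((\<lambda>t. Y t $ n) has_derivative (\<lambda>h. D h $ n)) (at t)"
    by (rule bounded_linear.has_derivative[OF bounded_linear_vec_nth D])
  then have "(\<lambda>t. Y t $ n) differentiable at t" by (auto simp: differentiable_def)
  from this[unfolded jacobian_works] 1
  have "(\<lambda>h. jacobian (\<lambda>t. Y t $ n) (at t) *v h) = (\<lambda>h. D h $ n)"
    by (rule has_derivative_unique)
  then show ?thesis by (simp add: row_jacobian_def fun_eq_iff)
qed

lemma full_jacobian_mult:
  assumes D: "(Y has_derivative D) (at t)"
  shows "full_jacobian Y t *v h = flatten (D h)"
proof -
  have "(full_jacobian Y t *v h) $ p = (row_jacobian Y (fst p) t *v h) $ snd p" for p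
    by (simp add: full_jacobian_def matrix_vector_mult_def)
  then show ?thesis
    by (simp add: vec_eq_iff row_jacobian_mult[OF D] flatten_def)
qed

text \<open>Writes each entry as a fixed linear functional of the derivative \<open>D\<close>, a
  form that can be differentiated once more.\<close>

lemma full_jacobian_nth:
  assumes D: "(Y has_derivative D) (at t)"
  shows "full_jacobian Y t $ p $ j = D (axis j 1) $ fst p $ snd p"
proof -
  have "full_jacobian Y t $ p $ j = (full_jacobian Y t *v axis j 1) $ p"
    by (simp add: matrix_vector_mult_basis column_def)
  then show ?thesis by (simp add: full_jacobian_mult[OF D] flatten_def)
qed

text \<open>The entries are evaluations of the derivative of \<open>Y\<close>, which is itself
  differentiable, so every row of the Jacobian is differentiable; the rows of the tensor are by
  definition the Jacobians of these rows.\<close>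

lemma full_jacobian_has_derivative:
  fixes Y :: "real^'s \<Rightarrow> real^'d^'n"
  assumes "C2_function Y"
  shows "(full_jacobian Y has_derivative (\<lambda>h. \<chi> p. second_derivative_tensor Y t $ p *v h)) (at t)"
proof -
  from assms obtain f' :: "real^'s \<Rightarrow> (real^'s) \<Rightarrow>\<^sub>L (real^'d^'n)" and f''
    where f': "\<And>x. (Y has_derivative blinfun_apply (f' x)) (at x)"
      and f'': "\<And>x. (f' has_derivative blinfun_apply (f'' x)) (at x)"
    unfolding C2_function_def C1_function_def by blast
  have "((\<lambda>t. full_jacobian Y t $ p) has_derivative
           (\<lambda>h. \<chi> j. blinfun_apply (blinfun_apply (f'' t) h) (axis j 1) $ fst p $ snd p)) (at t)" for p
    by (rule has_derivative_vecI)
       (simp add: full_jacobian_nth[OF f'] bounded_linear.has_derivative[OF bounded_linear_vec_nth]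
          bounded_linear.has_derivative[OF blinfun.bounded_linear_left] f'')
  then have "(\<lambda>t. full_jacobian Y t $ p) differentiable at t" for p
    by (rule differentiableI)
  note row = this[unfolded jacobian_works]
  show ?thesis
    by (rule has_derivative_vecI) (simp add: second_derivative_tensor_def row)
qed

text \<open>Mean value inequality on a convex set, the operator norm of the second derivative being
  at most the Frobenius norm of the tensor.\<close>

lemma full_jacobian_lipschitz:
  fixes Y :: "real^'s \<Rightarrow> real^'d^'n"
  assumes "C2_function Y" "convex S"
    and B: "\<And>t. t \<in> S \<Longrightarrow> norm (second_derivative_tensor Y t) \<le> B"
    and "x \<in> S" "y \<in> S"
  shows "norm (full_jacobian Y x - full_jacobian Y y) \<le> B * norm (x - y)"
proof (rule differentiable_bound[OF \<open>convex S\<close>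
        has_derivative_at_withinI[OF full_jacobian_has_derivative[OF assms(1)]] _ \<open>x \<in> S\<close> \<open>y \<in> S\<close>])
  fix t assume t: "t \<in> S"
  define T where "T = second_derivative_tensor Y t"
  have "norm (\<chi> p. T $ p *v h) \<le> norm T * norm h" for h
  proof -
    have "norm (\<chi> p. T $ p *v h) \<le> L2_set (\<lambda>p. norm (T $ p) * norm h) UNIV"
      unfolding norm_vec_def[of "\<chi> p. T $ p *v h"] by (intro L2_set_mono) (auto simp: norm_matrix_vector_mult_le)
    also have "\<dots> = norm T * norm h"
      by (simp add: norm_vec_def[of T] L2_set_left_distrib)
    finally show ?thesis .
  qed
  then have "onorm (\<lambda>h. \<chi> p. T $ p *v h) \<le> norm T" by (intro onorm_le)
  with B[OF t] show "onorm (\<lambda>h. \<chi> p. second_derivative_tensor Y t $ p *v h) \<le> B"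
    by (simp add: T_def)
qed

lemma lipschitz_of_full_jacobian_bound:
  fixes Y :: "real^'s \<Rightarrow> real^'d^'n"
  assumes Y: "\<And>t. Y differentiable at t" and S: "convex S"
    and B: "\<And>t. t \<in> S \<Longrightarrow> norm (full_jacobian Y t) \<le> B"
    and "x \<in> S" "y \<in> S"
  shows "norm (Y x - Y y) \<le> B * norm (x - y)"
proof -
  from Y obtain D where D: "\<And>t. (Y has_derivative D t) (at t)"
    unfolding differentiable_def by metis
  show ?thesis
  proof (rule differentiable_bound[OF \<open>convex S\<close> has_derivative_at_withinI[OF D] _ \<open>x \<in> S\<close> \<open>y \<in> S\<close>])
    fix t assume t: "t \<in> S"
    have "norm (D t h) \<le> norm (full_jacobian Y t) * norm h" for h
      using norm_matrix_vector_mult_le[of "full_jacobian Y t" h] by (simp add: full_jacobian_mult[OF D])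
    then have "onorm (D t) \<le> norm (full_jacobian Y t)" by (intro onorm_le)
    with B[OF t] show "onorm (D t) \<le> B" by simp
  qed
qed

text \<open>Choosing a batch amounts to zeroing the other rows of the loss gradient before
  multiplying by the full Jacobian. All batches then share one matrix, and their norms one
  bound.\<close>

lemma batch_gradient_eq:
  "batch_gradient Y F B t =
     flatten (\<chi> n. if n \<in> B then gradient F (Y t) $ n else 0) v* full_jacobian Y t"
proof -
  let ?g = "gradient F (Y t)"
  have "batch_gradient Y F B t $ j =
      (flatten (\<chi> n. if n \<in> B then ?g $ n else 0) v* full_jacobian Y t) $ j" for j
  proof -
    have "(flatten (\<chi> n. if n \<in> B then ?g $ n else 0) v* full_jacobian Y t) $ j =
      (\<Sum>n\<in>UNIV. \<Sum>i\<in>UNIV. (if n \<in> B then ?g $ n else 0) $ i * row_jacobian Y n t $ i $ j)"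
      by (simp add: vector_matrix_mult_def flatten_def full_jacobian_def sum.cartesian_product
            case_prod_beta mult.commute flip: UNIV_Times_UNIV)
    also have "\<dots> = (\<Sum>n\<in>UNIV. if n \<in> B then (?g $ n v* row_jacobian Y n t) $ j else 0)"
      by (intro sum.cong) (auto simp: vector_matrix_mult_def mult.commute)
    also have "\<dots> = batch_gradient Y F B t $ j"
      by (simp add: batch_gradient_def sum.If_cases)
    finally show ?thesis by simp
  qed
  then show ?thesis by (simp add: vec_eq_iff)
qed

lemma batch_gradient_UNIV: "batch_gradient Y F UNIV t = flatten (gradient F (Y t)) v* full_jacobian Y t"
  by (simp add: batch_gradient_eq)

lemma norm_batch_gradient_le:
  "norm (batch_gradient Y F B t) \<le> norm (gradient F (Y t)) * norm (full_jacobian Y t)"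
proof -
  let ?g = "\<chi> n. if n \<in> B then gradient F (Y t) $ n else 0"
  have "norm ?g \<le> norm (gradient F (Y t))"
    by (rule norm_le_componentwise_cart) auto
  then show ?thesis
    unfolding batch_gradient_eq
    by (intro norm_vector_matrix_mult_le[THEN order_trans] mult_right_mono) auto
qed

text \<open>Chain rule: the batch gradient of the whole sample is the true gradient of the loss as a
  function of the parameter.\<close>

lemma has_derivative_composite:
  fixes Y :: "real^'s \<Rightarrow> real^'d^'n"
  assumes "Y differentiable at t" "F differentiable at (Y t)"
  shows "((\<lambda>t. F (Y t)) has_derivative (\<lambda>h. batch_gradient Y F UNIV t \<bullet> h)) (at t)"
proof -
  from assms(1) obtain D where D: "(Y has_derivative D) (at t)" by (auto simp: differentiable_def)
  from has_derivative_compose[OF D has_derivative_gradient[OF assms(2)]] show ?thesis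
    by (simp add: batch_gradient_UNIV dot_lmul_matrix full_jacobian_mult[OF D])
qed

subsection \<open>Spectral and convexity estimates\<close>

text \<open>Eigenvectors of a symmetric matrix for distinct eigenvalues are orthogonal, hence
  independent. Finiteness is what gives \<open>Min\<close> in \<open>smallest_eigenvalue\<close> its
  meaning.\<close>

lemma finite_eigenvalues:
  fixes A :: "real^'m^'m"
  assumes sym: "transpose A = A"
  shows "finite {c. eigenvalue A c}"
proof -
  define E where "E = {c. eigenvalue A c}"
  have "\<forall>c\<in>E. \<exists>v. v \<noteq> 0 \<and> A *v v = c *s v"
    by (simp add: E_def eigenvalue_def)
  from bchoice[OF this] obtain v where v: "\<And>c. c \<in> E \<Longrightarrow> v c \<noteq> 0 \<and> A *v v c = c *s v c"
    by blast
  have orth: "v c \<bullet> v d = 0" if "c \<in> E" "d \<in> E" "c \<noteq> d" for c d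
  proof -
    have "c * (v c \<bullet> v d) = (A *v v c) \<bullet> v d"
      using v[OF that(1)] by (simp add: scalar_mult_eq_scaleR)
    also have "\<dots> = v c \<bullet> (A *v v d)"
      by (metis dot_lmul_matrix sym vector_transpose_matrix)
    also have "\<dots> = d * (v c \<bullet> v d)"
      using v[OF that(2)] by (simp add: scalar_mult_eq_scaleR)
    finally show ?thesis using that(3) by simp
  qed
  have "inj_on v E"
    \<comment> \<open>A vector shared by two distinct eigenvalues would be orthogonal to itself,
      hence zero.\<close>
    by (rule inj_onI) (metis inner_eq_zero_iff orth v)
  moreover have "finite (v ` E)"
  proof -
    have "pairwise orthogonal (v ` E)"
      by (auto simp: pairwise_def orthogonal_def intro: orth)
    moreover have "0 \<notin> v ` E" using v by force
    ultimately show ?thesis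
      using pairwise_orthogonal_independent independent_bound by blast
  qed
  ultimately show ?thesis
    unfolding E_def[symmetric] by (rule finite_imageD[rotated])
qed

text \<open>The minimum of the Rayleigh quotient over the unit sphere is an eigenvalue.\<close>

lemma smallest_eigenvalue_quadratic_form_le:
  fixes A :: "real^'m^'m"
  assumes sym: "transpose A = A"
  shows "smallest_eigenvalue A * (norm x)\<^sup>2 \<le> x \<bullet> (A *v x)"
proof -
  have cont: "continuous_on (sphere 0 1) (\<lambda>x. x \<bullet> (A *v x))"
    by (intro continuous_intros matrix_vector_mult_linear_continuous_on)
  have "axis undefined 1 \<in> sphere (0 :: real^'m) 1" by simp
  with continuous_attains_inf[OF compact_sphere _ cont] obtain v
    where v: "norm v = 1" and min: "\<And>y. norm y = 1 \<Longrightarrow> v \<bullet> (A *v v) \<le> y \<bullet> (A *v y)"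
    by (metis dist_0_norm empty_iff mem_sphere)
  define m where "m = v \<bullet> (A *v v)"
  \<comment> \<open>The form shifted by its minimum on the sphere: by homogeneity it is nonnegative
    everywhere, and it vanishes at \<open>v\<close>.\<close>
  define q where "q y = y \<bullet> (A *v y) - m * (y \<bullet> y)" for y
  have q: "0 \<le> q y" for y
  proof (cases "y = 0")
    case False
    define u where "u = y /\<^sub>R norm y"
    have y: "y = norm y *\<^sub>R u" using False by (simp add: u_def)
    have u: "norm u = 1" using False by (simp add: u_def)
    then have uu: "u \<bullet> u = 1" by (simp add: norm_eq_1)
    have "q y = (norm y)\<^sup>2 * (u \<bullet> (A *v u) - m)"
      by (subst (1) y)
         (simp add: q_def uu power2_eq_square matrix_vector_mult_scaleR algebra_simps)
    then show ?thesis using min[OF u] by (simp add: m_def)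
  qed (simp add: q_def)
  \<comment> \<open>First-order condition at the minimizer \<open>v\<close>: a nonzero slope in
    direction \<open>w\<close> would make \<open>q\<close> negative at some
    \<open>v + t *\<^sub>R w\<close>.\<close>
  have "w \<bullet> (A *v v - m *\<^sub>R v) = 0" for w
  proof (rule ccontr)
    let ?l = "w \<bullet> (A *v v - m *\<^sub>R v)"
    assume "?l \<noteq> 0"
    have wv: "v \<bullet> (A *v w) = w \<bullet> (A *v v)"
      by (metis dot_lmul_matrix inner_commute sym vector_transpose_matrix)
    have "v \<bullet> v = 1" using v by (simp add: norm_eq_1)
    then have exp: "q (v + t *\<^sub>R w) = t * (2 * ?l + t * q w)" for t
      by (simp add: q_def m_def[symmetric] matrix_vector_right_distrib matrix_vector_mult_scaleR
          inner_add_left inner_add_right inner_diff_right wv inner_commute[of w v] algebra_simps)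
    \<comment> \<open>The 1 in the denominator covers \<open>q w = 0\<close>; with this choice
      \<open>q (v + t *\<^sub>R w)\<close> equals \<open>- (t\<^sup>2 * (q w + 2))\<close>.\<close>
    define t where "t = - ?l / (q w + 1)"
    have pos: "0 < q w + 1" using q[of w] by simp
    have "t * (q w + 1) = - ?l" using pos by (simp add: t_def)
    then have "2 * ?l + t * q w = - t * (q w + 2)" by (simp add: algebra_simps)
    then have "t * (2 * ?l + t * q w) = - (t\<^sup>2 * (q w + 2))"
      by (simp add: power2_eq_square)
    also have "\<dots> < 0"
      using pos \<open>?l \<noteq> 0\<close> by (simp add: t_def)
    finally show False using q[of "v + t *\<^sub>R w"] by (simp add: exp)
  qed
  then have "A *v v - m *\<^sub>R v = 0" using inner_eq_zero_iff by blast
  then have "A *v v = m *s v" by (simp add: scalar_mult_eq_scaleR)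
  moreover have "v \<noteq> 0" using v by auto
  ultimately have "eigenvalue A m" by (auto simp: eigenvalue_def)
  then have "smallest_eigenvalue A \<le> m"
    unfolding smallest_eigenvalue_def by (intro Min_le finite_eigenvalues sym) simp
  then have "smallest_eigenvalue A * (x \<bullet> x) \<le> m * (x \<bullet> x)" by (intro mult_right_mono) auto
  with q[of x] show ?thesis by (simp add: q_def power2_norm_eq_inner)
qed

text \<open>The quadratic form of the Gram matrix at \<open>x\<close> is the squared norm of
  \<open>x v* J\<close>. Through this, (A5) bounds the parameter gradient from below by the output
  gradient.\<close>

lemma smallest_eigenvalue_gram_le:
  fixes J :: "real^'s^'m"
  shows "smallest_eigenvalue (J ** transpose J) * (norm x)\<^sup>2 \<le> (norm (x v* J))\<^sup>2"
proof -
  have "x \<bullet> ((J ** transpose J) *v x) = (norm (x v* J))\<^sup>2"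
    by (simp add: power2_norm_eq_inner dot_lmul_matrix flip: matrix_vector_mul_assoc)
  with smallest_eigenvalue_quadratic_form_le[of "J ** transpose J" x] show ?thesis
    by (simp add: matrix_transpose_mul)
qed

text \<open>On the segment from \<open>x\<close> to \<open>y\<close> convexity bounds the difference
  quotients by \<open>f y - f x\<close>; the limit is taken from the right, since only parameters in
  [0,1] stay on the segment.\<close>

lemma convex_on_tangent_le:
  fixes f :: "'a::real_normed_vector \<Rightarrow> real"
  assumes "convex_on S f" and D: "(f has_derivative D) (at x)" and "x \<in> S" "y \<in> S"
  shows "f x + D (y - x) \<le> f y"
proof -
  let ?p = "\<lambda>t. x + t *\<^sub>R (y - x)"
  have "((\<lambda>t. f (?p t)) has_derivative (\<lambda>t. D (t *\<^sub>R (y - x)))) (at (0::real))"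
    by (rule has_derivative_compose[where f' = "\<lambda>t. t *\<^sub>R (y - x)"])
       (auto intro!: derivative_eq_intros D)
  moreover have "(\<lambda>t. D (t *\<^sub>R (y - x))) = (*) (D (y - x))"
    using has_derivative_linear[OF D] by (simp add: fun_eq_iff linear_cmul)
  ultimately have "((\<lambda>t. f (?p t)) has_field_derivative D (y - x)) (at (0::real))"
    by (simp add: has_field_derivative_def)
  then have "((\<lambda>t. (f (?p t) - f x) / t) \<longlongrightarrow> D (y - x)) (at_right 0)"
    unfolding has_field_derivative_iff by (auto intro: tendsto_within_subset)
  moreover have "\<forall>\<^sub>F t in at_right 0. (f (?p t) - f x) / t \<le> f y - f x"
    using eventually_at_right_real[OF zero_less_one]
  proof eventually_elim
    fix t :: real assume t: "t \<in> {0<..<1}"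
    have "f ((1 - t) *\<^sub>R x + t *\<^sub>R y) \<le> (1 - t) * f x + t * f y"
      using convex_onD[OF assms(1), of t x y] t assms by auto
    also have "(1 - t) *\<^sub>R x + t *\<^sub>R y = ?p t" by (simp add: algebra_simps)
    finally show "(f (?p t) - f x) / t \<le> f y - f x"
      using t by (simp add: field_simps)
  qed
  ultimately have "D (y - x) \<le> f y - f x"
    by (intro tendsto_upperbound) auto
  then show ?thesis by simp
qed

lemma descent_lemma:
  fixes h :: "'a::real_inner \<Rightarrow> real"
  assumes "convex S"
    and D: "\<And>x. x \<in> S \<Longrightarrow> (h has_derivative (\<lambda>v. g x \<bullet> v)) (at x)"
    and lip: "\<And>x y. x \<in> S \<Longrightarrow> y \<in> S \<Longrightarrow> norm (g x - g y) \<le> K * norm (x - y)"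
    and x: "x \<in> S" and xw: "x + w \<in> S"
  shows "h (x + w) \<le> h x + g x \<bullet> w + K / 2 * (norm w)\<^sup>2"
proof -
  \<comment> \<open>The function along the segment minus its quadratic upper model, up to a
    constant. The Lipschitz bound makes the derivative nonpositive, so comparing the endpoints gives
    the claim.\<close>
  let ?\<psi> = "\<lambda>t. h (x + t *\<^sub>R w) - t * (g x \<bullet> w) - K / 2 * t\<^sup>2 * (norm w)\<^sup>2"
  have "?\<psi> 1 \<le> ?\<psi> 0"
  proof (rule DERIV_nonpos_imp_nonincreasing[where f = ?\<psi>])
    fix t :: real assume t: "0 \<le> t" "t \<le> 1"
    have "(1 - t) *\<^sub>R x + t *\<^sub>R (x + w) \<in> S"
      using t x xw by (intro convexD[OF \<open>convex S\<close>]) auto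
    then have S: "x + t *\<^sub>R w \<in> S" by (simp add: algebra_simps)
    let ?d = "(g (x + t *\<^sub>R w) - g x) \<bullet> w - K * t * (norm w)\<^sup>2"
    have "((\<lambda>t. h (x + t *\<^sub>R w)) has_derivative (\<lambda>s. g (x + t *\<^sub>R w) \<bullet> (s *\<^sub>R w))) (at t)"
      by (rule has_derivative_compose[where f' = "\<lambda>t. t *\<^sub>R w"])
         (auto intro!: derivative_eq_intros D S)
    then have "((\<lambda>t. h (x + t *\<^sub>R w)) has_field_derivative g (x + t *\<^sub>R w) \<bullet> w) (at t)"
      by (simp add: has_field_derivative_def mult_commute_abs)
    then have "(?\<psi> has_field_derivative ?d) (at t)"
      by (auto intro!: derivative_eq_intros simp: inner_diff_left algebra_simps)
    moreover have "(g (x + t *\<^sub>R w) - g x) \<bullet> w \<le> K * norm (t *\<^sub>R w) * norm w"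
      using lip[OF S x] by (intro order.trans[OF norm_cauchy_schwarz] mult_right_mono) auto
    then have "?d \<le> 0" using t by (simp add: power2_eq_square mult_ac)
    ultimately show "\<exists>d. (?\<psi> has_field_derivative d) (at t) \<and> d \<le> 0" by blast
  qed simp
  then show ?thesis by simp
qed

text \<open>For \<open>x = q * a k\<close> the recursion gives at most \<open>x - x\<^sup>2\<close>,
  which is at most x/(1+x). That map is increasing and sends 1/k to 1/(k+1), so induction
  closes.\<close>

lemma quadratic_recursion_bound:
  fixes a :: "nat \<Rightarrow> real"
  assumes nonneg: "\<And>k. 0 \<le> a k" and q: "0 < q"
    and rec: "\<And>k. a (Suc k) \<le> a k - q * (a k)\<^sup>2"
    and k: "1 \<le> k"
  shows "a k \<le> 1 / q / real k"
  using k
proof (induction k rule: dec_induct)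
  case base
  \<comment> \<open>Nonnegativity of the next term already forces \<open>a 1\<close> below 1/q, so
    the constant is independent of the initial value.\<close>
  have "q * (a 1)\<^sup>2 \<le> a 1" using rec[of 1] nonneg[of 2] by (simp add: numeral_2_eq_2)
  then show ?case using nonneg[of 1] q
    by (cases "a 1 = 0") (auto simp: power2_eq_square field_simps)
next
  case (step k)
  define x where "x = q * a k"
  have x: "0 \<le> x" "x \<le> 1 / real k"
    using step nonneg[of k] q by (auto simp: x_def field_simps)
  have "x - x\<^sup>2 \<le> x / (1 + x)"
    using x by (simp add: field_simps power2_eq_square)
  also have "\<dots> \<le> 1 / real (Suc k)"
    using x step by (simp add: field_simps)
  finally have "q * (a k - q * (a k)\<^sup>2) \<le> 1 / real (Suc k)"
    by (simp add: x_def algebra_simps power2_eq_square)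
  with rec[of k] q have "q * a (Suc k) \<le> 1 / real (Suc k)"
    by (meson mult_left_mono less_imp_le order_trans)
  then show ?case using q by (simp add: field_simps del: of_nat_Suc)
qed

subsection \<open>Stochastic descent\<close>

lemma batch_gradient_UNIV_lipschitz:
  fixes Y :: "real^'s \<Rightarrow> real^'d^'n"
  assumes Y: "C2_function Y" and S: "convex S" and YS: "Y ` S \<subseteq> V"
    and g_bound: "\<And>y. y \<in> V \<Longrightarrow> norm (gradient F y) \<le> B\<^sub>0"
    and g_lip: "\<And>y y'. y \<in> V \<Longrightarrow> y' \<in> V \<Longrightarrow> norm (gradient F y - gradient F y') \<le> L * norm (y - y')"
    and J_bound: "\<And>t. t \<in> S \<Longrightarrow> norm (full_jacobian Y t) \<le> B\<^sub>1"
    and H_bound: "\<And>t. t \<in> S \<Longrightarrow> norm (second_derivative_tensor Y t) \<le> B\<^sub>2"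
    and "0 \<le> L" "0 \<le> B\<^sub>1" "0 \<le> B\<^sub>2" and x: "x \<in> S" and y: "y \<in> S"
  shows "norm (batch_gradient Y F UNIV x - batch_gradient Y F UNIV y)
           \<le> (L * B\<^sub>1\<^sup>2 + B\<^sub>0 * B\<^sub>2) * norm (x - y)"
proof -
  let ?g = "\<lambda>t. gradient F (Y t)" and ?J = "full_jacobian Y"
  have V: "Y x \<in> V" "Y y \<in> V" using x y YS by auto
  have flat: "flatten a - flatten b = flatten (a - b)" for a b :: "real^'d^'n"
    by (simp add: flatten_def vec_eq_iff)
  have "norm (?g x - ?g y) \<le> L * (B\<^sub>1 * norm (x - y))"
    using g_lip[OF V] lipschitz_of_full_jacobian_bound[OF C2_function_differentiable[OF Y] S J_bound x y]
      \<open>0 \<le> L\<close> by (meson mult_left_mono order_trans)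
  then have 1: "norm (flatten (?g x - ?g y) v* ?J x) \<le> L * (B\<^sub>1 * norm (x - y)) * B\<^sub>1"
    using J_bound[OF x] \<open>0 \<le> L\<close> \<open>0 \<le> B\<^sub>1\<close>
    by (intro order.trans[OF norm_vector_matrix_mult_le] mult_mono) auto
  have "norm (?J x - ?J y) \<le> B\<^sub>2 * norm (x - y)"
    by (rule full_jacobian_lipschitz[OF Y S H_bound x y])
  then have 2: "norm (flatten (?g y) v* (?J x - ?J y)) \<le> B\<^sub>0 * (B\<^sub>2 * norm (x - y))"
    using g_bound[OF V(2)] \<open>0 \<le> B\<^sub>2\<close>
    by (intro order.trans[OF norm_vector_matrix_mult_le] mult_mono)
       (auto intro: order.trans[OF norm_ge_zero])
  \<comment> \<open>Product rule splitting: the first term varies the loss gradient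
    (\<open>L\<close> and \<open>B\<^sub>1\<close> twice), the second the Jacobian
    (\<open>B\<^sub>0\<close> and \<open>B\<^sub>2\<close>).\<close>
  have "batch_gradient Y F UNIV x - batch_gradient Y F UNIV y =
      flatten (?g x - ?g y) v* ?J x + flatten (?g y) v* (?J x - ?J y)"
    by (simp add: batch_gradient_UNIV algebra_simps flip: flat)
  also have "norm \<dots> \<le> L * (B\<^sub>1 * norm (x - y)) * B\<^sub>1 + B\<^sub>0 * (B\<^sub>2 * norm (x - y))"
    using 1 2 by (rule norm_triangle_mono)
  finally show ?thesis by (simp add: algebra_simps power2_eq_square)
qed

text \<open>The iterate at time \<open>k\<close> is determined by the batches before
  \<open>k\<close>; this makes it independent of the batch drawn at time \<open>k\<close>.\<close>

lemma sgd_iterate_cong: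
  "(\<And>j. j < k \<Longrightarrow> B j = B' j) \<Longrightarrow> sgd_iterate Y F \<eta> t B k = sgd_iterate Y F \<eta> t B' k"
  by (induction k) auto

context prob_space
begin

text \<open>A function of the first \<open>k\<close> variables factors through their restriction to
  \<open>{..<k}\<close>, which is independent of variable \<open>k\<close>. Since the values lie in
  a finite type, measurability and boundedness hold for arbitrary \<open>f\<close> and
  \<open>\<phi>\<close>.\<close>

lemma
  fixes X :: "nat \<Rightarrow> 'a \<Rightarrow> 'c::finite" and f :: "(nat \<Rightarrow> 'c) \<Rightarrow> real"
  assumes indep: "indep_vars (\<lambda>_. count_space UNIV) X UNIV"
    and dep: "\<And>x y. (\<And>i. i < k \<Longrightarrow> x i = y i) \<Longrightarrow> f x = f y"
  shows integrable_past: "integrable M (\<lambda>\<omega>. f (\<lambda>i. X i \<omega>))"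
    and integrable_past_mult_present: "integrable M (\<lambda>\<omega>. f (\<lambda>i. X i \<omega>) * \<phi> (X k \<omega>))"
    and expectation_past_mult_present:
      "expectation (\<lambda>\<omega>. f (\<lambda>i. X i \<omega>) * \<phi> (X k \<omega>)) =
         expectation (\<lambda>\<omega>. f (\<lambda>i. X i \<omega>)) * expectation (\<lambda>\<omega>. \<phi> (X k \<omega>))"
proof -
  let ?R = "\<lambda>A \<omega>. restrict (\<lambda>i. X i \<omega>) A"
  have indepR: "indep_var (PiM {..<k} (\<lambda>_. count_space UNIV)) (?R {..<k})
      (PiM {k} (\<lambda>_. count_space UNIV)) (?R {k})"
    by (rule indep_var_restrict[OF indep]) auto
  have PiM: "PiM {..<k} (\<lambda>_. count_space (UNIV :: 'c set)) = count_space (PiE {..<k} (\<lambda>_. UNIV))"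
    by (rule count_space_PiM_finite) auto
  \<comment> \<open>\<open>restrict\<close> puts \<open>undefined\<close> at indices from
    \<open>k\<close> on; by \<open>dep\<close> the value of \<open>f\<close> ignores them.\<close>
  have eq1: "f \<circ> ?R {..<k} = (\<lambda>\<omega>. f (\<lambda>i. X i \<omega>))"
    by (auto intro!: ext dep)
  have eq2: "(\<lambda>x. \<phi> (x k)) \<circ> ?R {k} = (\<lambda>\<omega>. \<phi> (X k \<omega>))" by auto
  have "indep_var borel (f \<circ> ?R {..<k}) borel ((\<lambda>x. \<phi> (x k)) \<circ> ?R {k})"
  proof (rule indep_var_compose[OF indepR])
    show "f \<in> borel_measurable (PiM {..<k} (\<lambda>_. count_space UNIV))" unfolding PiM by simp
    have "(\<lambda>x. x k) \<in> measurable (PiM {k} (\<lambda>_. count_space (UNIV :: 'c set))) (count_space UNIV)"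
      by (rule measurable_component_singleton) simp
    then show "(\<lambda>x. \<phi> (x k)) \<in> borel_measurable (PiM {k} (\<lambda>_. count_space UNIV))"
      by (rule measurable_compose) simp
  qed
  then have ind: "indep_var borel (\<lambda>\<omega>. f (\<lambda>i. X i \<omega>)) borel (\<lambda>\<omega>. \<phi> (X k \<omega>))"
    by (simp only: eq1 eq2)
  show int1: "integrable M (\<lambda>\<omega>. f (\<lambda>i. X i \<omega>))"
  proof (rule integrable_const_bound)
    have "finite ((\<lambda>x. norm (f x)) ` PiE {..<k} (\<lambda>_. UNIV))"
      by (intro finite_imageI finite_PiE) auto
    moreover have "norm (f (\<lambda>i. X i \<omega>)) \<in> (\<lambda>x. norm (f x)) ` PiE {..<k} (\<lambda>_. UNIV)" for \<omega>
      by (rule image_eqI[of _ _ "?R {..<k} \<omega>"]) (auto intro!: arg_cong[of _ _ abs] dep)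
    ultimately show "AE \<omega> in M. norm (f (\<lambda>i. X i \<omega>)) \<le> Max ((\<lambda>x. norm (f x)) ` PiE {..<k} (\<lambda>_. UNIV))"
      by (intro AE_I2 Max_ge)
  qed (use indep_var_rv1[OF ind] in simp)
  have int2: "integrable M (\<lambda>\<omega>. \<phi> (X k \<omega>))"
  proof (rule integrable_const_bound)
    show "AE \<omega> in M. norm (\<phi> (X k \<omega>)) \<le> Max (range (\<lambda>c. norm (\<phi> c)))"
      by (intro AE_I2 Max_ge) auto
  qed (use indep_var_rv2[OF ind] in simp)
  show "integrable M (\<lambda>\<omega>. f (\<lambda>i. X i \<omega>) * \<phi> (X k \<omega>))"
    by (rule indep_var_integrable[OF ind int1 int2])
  show "expectation (\<lambda>\<omega>. f (\<lambda>i. X i \<omega>) * \<phi> (X k \<omega>)) =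
         expectation (\<lambda>\<omega>. f (\<lambda>i. X i \<omega>)) * expectation (\<lambda>\<omega>. \<phi> (X k \<omega>))"
    by (rule indep_var_lebesgue_integral[OF ind int1 int2])
qed

lemma expectation_square_ge:
  fixes X :: "'a \<Rightarrow> real"
  assumes "integrable M X" "integrable M (\<lambda>\<omega>. (X \<omega>)\<^sup>2)"
  shows "(expectation X)\<^sup>2 \<le> expectation (\<lambda>\<omega>. (X \<omega>)\<^sup>2)"
  using variance_eq[OF assms] variance_positive[of X] by simp

end

theorem theorem3p6:
  fixes Y :: "real^'s \<Rightarrow> real^'d^'n"
    and F :: "real^'d^'n \<Rightarrow> real"
    and \<Omega> :: "(real^'s) set"
    and V :: "(real^'d^'n) set"
    and Ystar :: "real^'d^'n"
    and r B\<^sub>0 L B\<^sub>1 B\<^sub>2 \<mu>\<^sub>m\<^sub>i\<^sub>n c\<^sub>2 \<eta> :: real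
    and \<theta>\<^sub>0 :: "real^'s"
    and b :: nat
    and M :: "'a measure"
    and batch :: "nat \<Rightarrow> 'a \<Rightarrow> 'n set"
    and \<theta> :: "nat \<Rightarrow> 'a \<Rightarrow> real^'s"
  assumes Y_C2: "C2_function Y"
    and F_C1: "C1_function F"
    and \<Omega>: "open \<Omega>" "convex \<Omega>"
    and V: "0 < r" "V = ball Ystar r"
    and Y_maps: "Y ` \<Omega> \<subseteq> V"
    and pos: "0 < B\<^sub>0" "0 < L" "0 < B\<^sub>1" "0 < B\<^sub>2" "0 < \<mu>\<^sub>m\<^sub>i\<^sub>n"
    and A1: "\<forall>y\<in>V. norm (gradient F y) \<le> B\<^sub>0"
    and A2: "\<forall>y\<in>V. \<forall>y'\<in>V. norm (gradient F y - gradient F y') \<le> L * norm (y - y')"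
    and A3: "\<forall>t\<in>\<Omega>. norm (full_jacobian Y t) \<le> B\<^sub>1"
    and A4: "\<forall>t\<in>\<Omega>. norm (second_derivative_tensor Y t) \<le> B\<^sub>2"
    and A5: "\<forall>t\<in>\<Omega>. \<mu>\<^sub>m\<^sub>i\<^sub>n \<le> smallest_eigenvalue (full_jacobian Y t ** transpose (full_jacobian Y t))"
    and prob: "prob_space M"
    and batch_indep: "prob_space.indep_vars M (\<lambda>_. count_space UNIV) batch UNIV"
    and batch_size: "\<forall>k. AE \<omega> in M. card (batch k \<omega>) = b"
    and batch_prob: "\<forall>k n. measure M {\<omega> \<in> space M. n \<in> batch k \<omega>} = real b / real CARD('n)"
    and iterates: "\<forall>k \<omega>. \<theta> k \<omega> = sgd_iterate Y F \<eta> \<theta>\<^sub>0 (\<lambda>j. batch j \<omega>) k"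
    and iterates_in: "AE \<omega> in M. \<forall>k. \<theta> k \<omega> \<in> \<Omega>"
    and F_convex: "convex_on V F"
    and minimum: "is_arg_min F (\<lambda>y. y \<in> V) Ystar"
    and c2: "c\<^sub>2 = 1 / 2 * (L * B\<^sub>1\<^sup>2 + B\<^sub>0 * B\<^sub>2) * B\<^sub>1\<^sup>2"
    and step: "0 < \<eta>" "\<eta> < (real b / real CARD('n)) * (\<mu>\<^sub>m\<^sub>i\<^sub>n / c\<^sub>2)"
  shows "\<exists>C>0. \<forall>k\<ge>1. prob_space.expectation M (\<lambda>\<omega>. F (Y (\<theta> k \<omega>))) - F Ystar \<le> C / real k"
proof -
  interpret prob_space M by fact

  \<comment> \<open>Deterministic estimates on the local region\<close>
  define h where "h t = F (Y t)" for t
  define G where "G = batch_gradient Y F"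
  define g where "g t = (norm (gradient F (Y t)))\<^sup>2" for t
  define p where "p = real b / real CARD('n)"
  define K where "K = L * B\<^sub>1\<^sup>2 + B\<^sub>0 * B\<^sub>2"
  \<comment> \<open>Net decrease per unit of squared output gradient: first-order gain minus
    second-order loss. The step size condition states exactly that the bracket is positive.\<close>
  define \<delta> where "\<delta> = \<eta> * (p * \<mu>\<^sub>m\<^sub>i\<^sub>n - \<eta> * c\<^sub>2)"
  have K: "0 < K" using pos by (simp add: K_def add_pos_pos)
  have c2_eq: "c\<^sub>2 = K / 2 * B\<^sub>1\<^sup>2" by (simp add: c2 K_def)
  have "0 < c\<^sub>2" using K pos by (simp add: c2_eq)
  then have \<delta>: "0 < \<delta>" using step by (simp add: \<delta>_def p_def field_simps)
  have YV: "Y t \<in> V" if "t \<in> \<Omega>" for t using that Y_maps by auto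
  have "Ystar \<in> V" using V by simp
  have der_F: "(F has_derivative (\<lambda>v. gradient F y \<bullet> v)) (at y)" for y
    by (rule has_derivative_gradient[OF C1_function_differentiable[OF F_C1]])
  have der_h: "(h has_derivative (\<lambda>v. G UNIV t \<bullet> v)) (at t)" for t
    unfolding h_def G_def
    by (intro has_derivative_composite C2_function_differentiable[OF Y_C2] C1_function_differentiable[OF F_C1])
  have lip: "norm (G UNIV x - G UNIV y) \<le> K * norm (x - y)" if "x \<in> \<Omega>" "y \<in> \<Omega>" for x y
    unfolding G_def K_def
    by (rule batch_gradient_UNIV_lipschitz[OF Y_C2 \<Omega>(2) Y_maps]) (use that pos A1 A2 A3 A4 in auto)
  have G_norm: "(norm (G B t))\<^sup>2 \<le> B\<^sub>1\<^sup>2 * g t" if "t \<in> \<Omega>" for B t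
  proof -
    have "norm (G B t) \<le> norm (gradient F (Y t)) * norm (full_jacobian Y t)"
      unfolding G_def by (rule norm_batch_gradient_le)
    also have "\<dots> \<le> norm (gradient F (Y t)) * B\<^sub>1"
      using A3 that by (intro mult_left_mono) auto
    finally have "(norm (G B t))\<^sup>2 \<le> (norm (gradient F (Y t)) * B\<^sub>1)\<^sup>2"
      by (intro power_mono) auto
    then show ?thesis by (simp add: g_def power_mult_distrib mult.commute)
  qed
  have G_lower: "\<mu>\<^sub>m\<^sub>i\<^sub>n * g t \<le> (norm (G UNIV t))\<^sup>2" if "t \<in> \<Omega>" for t
  proof -
    let ?J = "full_jacobian Y t"
    have "\<mu>\<^sub>m\<^sub>i\<^sub>n * g t \<le> smallest_eigenvalue (?J ** transpose ?J) * (norm (flatten (gradient F (Y t))))\<^sup>2"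
      using A5 that by (auto simp: g_def intro: mult_right_mono)
    also have "\<dots> \<le> (norm (G UNIV t))\<^sup>2"
      unfolding G_def batch_gradient_UNIV by (rule smallest_eigenvalue_gram_le)
    finally show ?thesis .
  qed
  have h_min: "F Ystar \<le> h t" if "t \<in> \<Omega>" for t
    using minimum YV[OF that] by (auto simp: is_arg_min_def h_def not_less)
  \<comment> \<open>The tangent at \<open>Y t\<close> is evaluated at the centre
    \<open>Ystar\<close>, at distance less than \<open>r\<close>; \<open>h_min\<close> supplies the
    sign that permits squaring.\<close>
  have gap: "(h t - F Ystar)\<^sup>2 \<le> r\<^sup>2 * g t" if "t \<in> \<Omega>" for t
  proof -
    have "h t + gradient F (Y t) \<bullet> (Ystar - Y t) \<le> F Ystar"
      unfolding h_def by (rule convex_on_tangent_le[OF F_convex der_F YV[OF that] \<open>Ystar \<in> V\<close>])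
    then have "h t - F Ystar \<le> gradient F (Y t) \<bullet> (Y t - Ystar)" by (simp add: inner_diff_right)
    also have "\<dots> \<le> norm (gradient F (Y t)) * norm (Y t - Ystar)" by (rule norm_cauchy_schwarz)
    also have "\<dots> \<le> norm (gradient F (Y t)) * r"
      using YV[OF that] V by (intro mult_left_mono) (auto simp: dist_norm norm_minus_commute)
    finally have "(h t - F Ystar)\<^sup>2 \<le> (norm (gradient F (Y t)) * r)\<^sup>2"
      using h_min[OF that] by (intro power_mono) auto
    then show ?thesis by (simp add: g_def power_mult_distrib mult.commute)
  qed
  \<comment> \<open>Writing the batch sum over all samples with membership indicators lets linearity
    of expectation bring in the inclusion probability of each sample.\<close>
  have G_sum: "G UNIV t \<bullet> G B t = (\<Sum>n\<in>UNIV. (G UNIV t \<bullet> G {n} t) * indicator B n)" for B t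
  proof -
    have "G B t = (\<Sum>n\<in>B. G {n} t)" by (simp add: G_def batch_gradient_def)
    then show ?thesis by (simp add: inner_sum_right indicator_def sum.If_cases if_distrib cong: if_cong)
  qed
  have descent: "h (t - \<eta> *\<^sub>R G B t) \<le> h t - \<eta> * (G UNIV t \<bullet> G B t) + \<eta>\<^sup>2 * c\<^sub>2 * g t"
    if t: "t \<in> \<Omega>" "t - \<eta> *\<^sub>R G B t \<in> \<Omega>" for B t
  proof -
    have "h (t + - \<eta> *\<^sub>R G B t) \<le> h t + G UNIV t \<bullet> (- \<eta> *\<^sub>R G B t) + K / 2 * (norm (- \<eta> *\<^sub>R G B t))\<^sup>2"
      using t by (intro descent_lemma[OF \<Omega>(2) der_h lip]) auto
    also have "K / 2 * (norm (- \<eta> *\<^sub>R G B t))\<^sup>2 = K / 2 * \<eta>\<^sup>2 * (norm (G B t))\<^sup>2"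
      by (simp add: power_mult_distrib)
    also have "\<dots> \<le> K / 2 * \<eta>\<^sup>2 * (B\<^sub>1\<^sup>2 * g t)"
      using G_norm[OF t(1)] K by (intro mult_left_mono) auto
    finally show ?thesis by (simp add: c2_eq mult_ac)
  qed

  \<comment> \<open>Expectations over the batches\<close>
  have dep: "\<phi> (sgd_iterate Y F \<eta> \<theta>\<^sub>0 x k) = \<phi> (sgd_iterate Y F \<eta> \<theta>\<^sub>0 y k)"
    if "\<And>i. i < k \<Longrightarrow> x i = y i" for \<phi> :: "real^'s \<Rightarrow> real" and k x y
    by (rule arg_cong[of _ _ \<phi>], rule sgd_iterate_cong, rule that)
  have \<theta>_eq: "\<theta> k \<omega> = sgd_iterate Y F \<eta> \<theta>\<^sub>0 (\<lambda>i. batch i \<omega>) k" for k \<omega>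
    using iterates by blast
  \<comment> \<open>\<open>\<theta> k\<close> depends on finitely many batches from a finite type
    and so takes finitely many values; hence every real function of it is integrable.\<close>
  have int: "integrable M (\<lambda>\<omega>. \<phi> (\<theta> k \<omega>))" for \<phi> :: "real^'s \<Rightarrow> real" and k
    unfolding \<theta>_eq by (rule integrable_past[OF batch_indep dep])
  have int_ind: "integrable M (\<lambda>\<omega>. \<phi> (\<theta> k \<omega>) * indicator (batch k \<omega>) n)"
    for \<phi> :: "real^'s \<Rightarrow> real" and k n
    unfolding \<theta>_eq
    by (rule integrable_past_mult_present[OF batch_indep dep, where \<phi> = "\<lambda>B. indicator B n"])
  have E_ind: "expectation (\<lambda>\<omega>. \<phi> (\<theta> k \<omega>) * indicator (batch k \<omega>) n) = p * expectation (\<lambda>\<omega>. \<phi> (\<theta> k \<omega>))"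
    for \<phi> :: "real^'s \<Rightarrow> real" and k n
  proof -
    have "expectation (\<lambda>\<omega>. indicator (batch k \<omega>) n) =
        expectation (indicator {\<omega> \<in> space M. n \<in> batch k \<omega>})"
      by (intro Bochner_Integration.integral_cong) (auto simp: indicator_def)
    also have "\<dots> = p"
      using batch_prob by (simp add: p_def Int_absorb2 Collect_restrict)
    finally have "expectation (\<lambda>\<omega>. indicator (batch k \<omega>) n) = p" .
    moreover have "expectation (\<lambda>\<omega>. \<phi> (\<theta> k \<omega>) * indicator (batch k \<omega>) n) =
        expectation (\<lambda>\<omega>. \<phi> (\<theta> k \<omega>)) * expectation (\<lambda>\<omega>. indicator (batch k \<omega>) n)"
      unfolding \<theta>_eq
      by (rule expectation_past_mult_present[OF batch_indep dep, where \<phi> = "\<lambda>B. indicator B n"])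
    ultimately show ?thesis by simp
  qed
  have G_sum_UNIV: "(\<Sum>n\<in>UNIV. G UNIV t \<bullet> G {n} t) = (norm (G UNIV t))\<^sup>2" for t
    using G_sum[of t UNIV, symmetric] by (simp add: power2_norm_eq_inner)
  have G_batch: "(\<lambda>\<omega>. G UNIV (\<theta> k \<omega>) \<bullet> G (batch k \<omega>) (\<theta> k \<omega>)) =
      (\<lambda>\<omega>. \<Sum>n\<in>UNIV. (G UNIV (\<theta> k \<omega>) \<bullet> G {n} (\<theta> k \<omega>)) * indicator (batch k \<omega>) n)" for k
    by (rule ext) (rule G_sum)
  let ?u = "\<lambda>n t. G UNIV t \<bullet> G {n} t"
  \<comment> \<open>The batch gradient is unbiased up to the factor \<open>p\<close>: each summand
    separates into a function of the past and the indicator of the present batch.\<close>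
  have E_G: "expectation (\<lambda>\<omega>. G UNIV (\<theta> k \<omega>) \<bullet> G (batch k \<omega>) (\<theta> k \<omega>)) =
      p * expectation (\<lambda>\<omega>. (norm (G UNIV (\<theta> k \<omega>)))\<^sup>2)" for k
  proof -
    have "expectation (\<lambda>\<omega>. G UNIV (\<theta> k \<omega>) \<bullet> G (batch k \<omega>) (\<theta> k \<omega>)) =
        (\<Sum>n\<in>UNIV. expectation (\<lambda>\<omega>. ?u n (\<theta> k \<omega>) * indicator (batch k \<omega>) n))"
      unfolding G_batch
      by (rule Bochner_Integration.integral_sum) (rule int_ind[of "?u n" k n for n])
    also have "\<dots> = (\<Sum>n\<in>UNIV. p * expectation (\<lambda>\<omega>. ?u n (\<theta> k \<omega>)))"
      by (rule sum.cong[OF refl]) (rule E_ind[of "?u n" k n for n])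
    also have "\<dots> = p * expectation (\<lambda>\<omega>. \<Sum>n\<in>UNIV. ?u n (\<theta> k \<omega>))"
      using int[of "?u n" k for n] by (simp add: sum_distrib_left)
    also have "(\<lambda>\<omega>. \<Sum>n\<in>UNIV. ?u n (\<theta> k \<omega>)) = (\<lambda>\<omega>. (norm (G UNIV (\<theta> k \<omega>)))\<^sup>2)"
      by (rule ext) (rule G_sum_UNIV)
    finally show ?thesis .
  qed
  have int_G: "integrable M (\<lambda>\<omega>. G UNIV (\<theta> k \<omega>) \<bullet> G (batch k \<omega>) (\<theta> k \<omega>))" for k
    unfolding G_batch
    by (rule Bochner_Integration.integrable_sum) (rule int_ind[of "?u n" k n for n])

  \<comment> \<open>Recursion for the expected gap\<close>
  define a where "a k = expectation (\<lambda>\<omega>. h (\<theta> k \<omega>) - F Ystar)" for k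
  have a_eq: "a k = expectation (\<lambda>\<omega>. h (\<theta> k \<omega>)) - F Ystar" for k
    by (simp add: a_def int prob_space)
  have \<theta>_in: "AE \<omega> in M. \<theta> k \<omega> \<in> \<Omega>" for k
    using iterates_in by eventually_elim blast
  have "0 \<le> a k" for k
    unfolding a_def using \<theta>_in[of k] by (intro integral_nonneg_AE) (auto elim!: eventually_mono intro: h_min)
  moreover have "a (Suc k) \<le> a k - \<delta> / r\<^sup>2 * (a k)\<^sup>2" for k
  proof -
    let ?E = "\<lambda>\<phi>. expectation (\<lambda>\<omega>. \<phi> (\<theta> k \<omega>))"
    have "expectation (\<lambda>\<omega>. h (\<theta> (Suc k) \<omega>)) \<le>
        expectation (\<lambda>\<omega>. h (\<theta> k \<omega>) - \<eta> * (G UNIV (\<theta> k \<omega>) \<bullet> G (batch k \<omega>) (\<theta> k \<omega>)) + \<eta>\<^sup>2 * c\<^sub>2 * g (\<theta> k \<omega>))"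
    proof (rule integral_mono_AE)
      show "AE \<omega> in M. h (\<theta> (Suc k) \<omega>) \<le>
          h (\<theta> k \<omega>) - \<eta> * (G UNIV (\<theta> k \<omega>) \<bullet> G (batch k \<omega>) (\<theta> k \<omega>)) + \<eta>\<^sup>2 * c\<^sub>2 * g (\<theta> k \<omega>)"
        using \<theta>_in[of k] \<theta>_in[of "Suc k"]
      proof eventually_elim
        case (elim \<omega>)
        have "\<theta> (Suc k) \<omega> = \<theta> k \<omega> - \<eta> *\<^sub>R G (batch k \<omega>) (\<theta> k \<omega>)" by (simp add: \<theta>_eq G_def)
        with descent[of "\<theta> k \<omega>" "batch k \<omega>"] elim show ?case by simp
      qed
    qed (intro Bochner_Integration.integrable_add Bochner_Integration.integrable_diff
          Bochner_Integration.integrable_mult_right int int_G)+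
    also have "\<dots> = ?E h - \<eta> * (p * ?E (\<lambda>t. (norm (G UNIV t))\<^sup>2)) + \<eta>\<^sup>2 * c\<^sub>2 * ?E g"
      by (simp add: int int_G E_G)
    \<comment> \<open>(A5) turns the first-order gain into a multiple of \<open>?E g\<close>, the
      quantity that also measures the second-order loss, so the two combine into
      \<open>\<delta>\<close>.\<close>
    also have "\<dots> \<le> ?E h - \<eta> * (p * (\<mu>\<^sub>m\<^sub>i\<^sub>n * ?E g)) + \<eta>\<^sup>2 * c\<^sub>2 * ?E g"
    proof -
      have "?E (\<lambda>t. \<mu>\<^sub>m\<^sub>i\<^sub>n * g t) \<le> ?E (\<lambda>t. (norm (G UNIV t))\<^sup>2)"
        using \<theta>_in[of k] by (intro integral_mono_AE int[of "\<lambda>t. \<mu>\<^sub>m\<^sub>i\<^sub>n * g t"]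
            int[of "\<lambda>t. (norm (G UNIV t))\<^sup>2"]) (auto elim!: eventually_mono intro: G_lower)
      then have "\<mu>\<^sub>m\<^sub>i\<^sub>n * ?E g \<le> ?E (\<lambda>t. (norm (G UNIV t))\<^sup>2)" by simp
      then have "\<eta> * (p * (\<mu>\<^sub>m\<^sub>i\<^sub>n * ?E g)) \<le> \<eta> * (p * ?E (\<lambda>t. (norm (G UNIV t))\<^sup>2))"
        using step(1) by (intro mult_left_mono) (auto simp: p_def)
      then show ?thesis by simp
    qed
    also have "\<dots> = ?E h - \<delta> * ?E g" by (simp add: \<delta>_def algebra_simps power2_eq_square)
    finally have 1: "a (Suc k) \<le> a k - \<delta> * ?E g" by (simp add: a_eq)
    \<comment> \<open>Jensen for the square, in the form of nonnegative variance, moves the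
      pointwise bound \<open>gap\<close> to the expected gap.\<close>
    have "(a k)\<^sup>2 \<le> ?E (\<lambda>t. (h t - F Ystar)\<^sup>2)"
      unfolding a_def
      by (intro expectation_square_ge int[of "\<lambda>t. h t - F Ystar"]
          int[of "\<lambda>t. (h t - F Ystar)\<^sup>2"])
    also have "\<dots> \<le> ?E (\<lambda>t. r\<^sup>2 * g t)"
      using \<theta>_in[of k] by (intro integral_mono_AE int[of "\<lambda>t. r\<^sup>2 * g t"]
          int[of "\<lambda>t. (h t - F Ystar)\<^sup>2"]) (auto elim!: eventually_mono intro: gap)
    finally have "(a k)\<^sup>2 \<le> r\<^sup>2 * ?E g" by simp
    then have "(a k)\<^sup>2 / r\<^sup>2 \<le> ?E g" using V by (simp add: field_simps)
    then have "\<delta> * ((a k)\<^sup>2 / r\<^sup>2) \<le> \<delta> * ?E g" using \<delta> by (intro mult_left_mono) auto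
    with 1 show ?thesis by simp
  qed
  moreover have q: "0 < \<delta> / r\<^sup>2" using \<delta> V by simp
  \<comment> \<open>The constant is thus \<open>r\<^sup>2 / \<delta>\<close>.\<close>
  ultimately have "a k \<le> 1 / (\<delta> / r\<^sup>2) / real k" if "1 \<le> k" for k
    using that by (intro quadratic_recursion_bound) auto
  moreover have "0 < 1 / (\<delta> / r\<^sup>2)" using q by (rule divide_pos_pos[OF zero_less_one])
  ultimately show ?thesis unfolding a_eq h_def by blast
qed

end
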